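(* Let $\{A,A',A''\}\subseteq\mathbb{CP}^2$ be a basis (three points represented by an orthonormal basis of $\mathbb{C}^3$). Let $m\subseteq\mathbb{CP}^2$ be the complex projective line passing through $A'$ and $A''$ (equivalently, the set of points at maximal distance from $A$), and let $S^1\subseteq m$ be the great circle of points of $m$ equidistant from $A'$ and $A''$. Let $E,E',E''\in S^1$ be the vertices of an equilateral triangle in $S^1$. Let $\ell\subseteq\mathbb{CP}^2$ be the complex projective line through $A$ and $E$, and let $B,C,D\in\ell$ be points such that $A,B,C,D$ is an equidistant $4$-tuple of distinct points on $\ell$ (the vertices of a regular tetrahedron inscribed in the round $2$-sphere $\ell$). For each $X\in\{B,C,D\}$ let $\gamma_{AXE}\subseteq\ell$ be the great circle (closed geodesic) through $A$, $X$ and $E$, and let $\mathbb{RP}^2_X\subseteq\mathbb{CP}^2$ be the real projective plane that includes both $\gamma_{AXE}$ and $S^1$. Let $\gamma^X_{AE'}\subseteq\mathbb{RP}^2_X$ and $\gamma^X_{AE''}\subseteq\mathbb{RP}^2_X$ be the closed geodesics of $\mathbb{RP}^2_X$ through $A,E'$ and through $A,E''$, respectively. Then for each $X\in\{B,C,D\}$ one can choose points $X'\in\gamma^X_{AE'}$ and $X''\in\gamma^X_{AE''}$ such that $\{X,X',X''\}\subseteq\mathbb{RP}^2_X$ is a basis, in such a way that the four bases $$\{A,A',A''\},\quad \{B,B',B''\},\quad \{C,C',C''\},\quad \{D,D',D''\}$$ are pairwise mutually unbiased, i.e. form a complete system of mutually unbiased bases in $\mathbb{C}^3$.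
   Context: $\mathbb{C}^n$ carries its standard Hermitian inner product $\langle\cdot,\cdot\rangle$. Two orthonormal bases $(e_i)$ and $(f_j)$ of $\mathbb{C}^n$ are mutually unbiased if $|\langle e_i,f_j\rangle|$ is independent of $i$ and $j$ (and hence equals $1/\sqrt{n}$ for all $i,j$). A complete system of mutually unbiased bases in $\mathbb{C}^n$ is a system of $n+1$ pairwise mutually unbiased orthonormal bases. $\mathbb{CP}^2$ is the set of complex lines in $\mathbb{C}^3$, with the Fubini–Study metric normalized so that the sectional curvature satisfies $\frac14\le K\le 1$. The distance between the points represented by unit vectors $v,w$ is $d([v],[w])=2\arccos|\langle v,w\rangle|$, so the maximal distance is $\pi$, attained exactly when $v\perp w$. Each complex projective line (the set of complex lines contained in a $2$-dimensional complex subspace of $\mathbb{C}^3$) is isometric to the unit $2$-sphere; great circles, antipodal points and equidistant points in it are understood in this sense. A set of three points of $\mathbb{CP}^2$ is called a basis if the points are pairwise at distance $\pi$, i.e. unit vectors representing them form an orthonormal basis of $\mathbb{C}^3$. Whether two bases are mutually unbiased does not depend on the choice of unit representatives, so the notion applies to bases in $\mathbb{CP}^2$. A real projective plane $\mathbb{RP}^2\subseteq\mathbb{CP}^2$ is a totally geodesic one: the set of points $[v]$ with $v$ a nonzero vector in the real linear span of some orthonormal $\mathbb{C}$-basis of $\mathbb{C}^3$. Its closed geodesics are the sets of points $[v]$ with $v$ a nonzero vector in a $2$-dimensional real subspace of that real span. An equilateral triangle $EE'E''$ in $S^1$ means three points of the great circle $S^1$ (of length $2\pi$) with pairwise distances $2\pi/3$.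 In the configuration of the theorem, $E$ is the point $\ell\cap m$, antipodal to $A$ in $\ell$. *)

theory Defs
  imports "HOL-Analysis.Analysis"
begin

section \<open>Hermitian space and mutually unbiased bases\<close>

definition herm :: "complex ^ 'n \<Rightarrow> complex ^ 'n \<Rightarrow> complex" where
  "herm v w = (\<Sum>i\<in>UNIV. v $ i * cnj (w $ i))"

text \<open>Unqualified \<open>span\<close>, \<open>subspace\<close>, \<open>dim\<close> refer to the real vector space structure
  of \<open>complex ^ 'n\<close>, and \<open>vec.span\<close>, \<open>vec.subspace\<close>, \<open>vec.dim\<close> to the complex one.\<close>

definition orthonormal_basis :: "('n \<Rightarrow> complex ^ 'n) \<Rightarrow> bool" where
  "orthonormal_basis e \<longleftrightarrow>
     (\<forall>i j. herm (e i) (e j) = (if i = j then 1 else 0)) \<and> vec.span (range e) = UNIV"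

definition mutually_unbiased :: "('n \<Rightarrow> complex ^ 'n) \<Rightarrow> ('n \<Rightarrow> complex ^ 'n) \<Rightarrow> bool" where
  "mutually_unbiased e f \<longleftrightarrow>
     orthonormal_basis e \<and> orthonormal_basis f \<and> (\<exists>c. \<forall>i j. cmod (herm (e i) (f j)) = c)"

definition complete_MUB_system :: "('n \<Rightarrow> complex ^ 'n) list \<Rightarrow> bool" where
  "complete_MUB_system es \<longleftrightarrow>
     length es = CARD('n) + 1 \<and> (\<forall>e\<in>set es. orthonormal_basis e) \<and>
     (\<forall>i<length es. \<forall>j<length es. i \<noteq> j \<longrightarrow> mutually_unbiased (es ! i) (es ! j))"


section \<open>The complex projective plane\<close>

type_synonym cpoint = "(complex ^ 3) set"

definition CP2 :: "cpoint set" where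
  "CP2 = {L. vec.subspace L \<and> vec.dim L = 1}"

text \<open>The point \<open>[v]\<close>; it belongs to \<open>CP2\<close> when \<open>v \<noteq> 0\<close>.\<close>

definition cline :: "complex ^ 3 \<Rightarrow> cpoint" where
  "cline v = vec.span {v}"

text \<open>The Fubini--Study distance with sectional curvature between \<open>1/4\<close> and \<open>1\<close>.
  For \<open>P\<close>, \<open>Q\<close> in \<open>CP2\<close> the described number exists and does not depend on the
  unit vectors.\<close>

definition fs_dist :: "cpoint \<Rightarrow> cpoint \<Rightarrow> real" where
  "fs_dist P Q = (THE d. \<exists>v\<in>P. \<exists>w\<in>Q. norm v = 1 \<and> norm w = 1 \<and> d = 2 * arccos (cmod (herm v w)))"

definition cp_basis :: "cpoint set \<Rightarrow> bool" where
  "cp_basis S \<longleftrightarrow> S \<subseteq> CP2 \<and> card S = 3 \<and> pairwise (\<lambda>P Q. fs_dist P Q = pi) S"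

definition represents :: "(3 \<Rightarrow> complex ^ 3) \<Rightarrow> cpoint set \<Rightarrow> bool" where
  "represents e S \<longleftrightarrow> orthonormal_basis e \<and> range (\<lambda>i. cline (e i)) = S"

definition cp_mutually_unbiased :: "cpoint set \<Rightarrow> cpoint set \<Rightarrow> bool" where
  "cp_mutually_unbiased S T \<longleftrightarrow>
     cp_basis S \<and> cp_basis T \<and>
     (\<exists>e f. represents e S \<and> represents f T \<and> mutually_unbiased e f)"

definition equidistant :: "cpoint set \<Rightarrow> bool" where
  "equidistant S \<longleftrightarrow> (\<exists>r. pairwise (\<lambda>P Q. fs_dist P Q = r) S)"

definition complex_projective_line :: "cpoint set \<Rightarrow> bool" where
  "complex_projective_line l \<longleftrightarrow>
     (\<exists>W. vec.subspace W \<and> vec.dim W = 2 \<and> l = {P \<in> CP2. P \<subseteq> W})"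

text \<open>Isometries from the round unit 2-sphere, whose distance is the angle, onto \<open>l\<close>.\<close>

definition sphere_isometry :: "(real ^ 3 \<Rightarrow> cpoint) \<Rightarrow> cpoint set \<Rightarrow> bool" where
  "sphere_isometry \<phi> l \<longleftrightarrow>
     bij_betw \<phi> (sphere 0 1) l \<and>
     (\<forall>x\<in>sphere 0 1. \<forall>y\<in>sphere 0 1. fs_dist (\<phi> x) (\<phi> y) = arccos (x \<bullet> y))"

definition great_circle_in :: "cpoint set \<Rightarrow> cpoint set \<Rightarrow> bool" where
  "great_circle_in l \<gamma> \<longleftrightarrow>
     (\<exists>\<phi> V. sphere_isometry \<phi> l \<and> subspace V \<and> dim V = 2 \<and> \<gamma> = \<phi> ` (sphere 0 1 \<inter> V))"

definition real_points :: "(complex ^ 3) set \<Rightarrow> cpoint set" where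
  "real_points V = cline ` (V - {0})"

definition real_projective_plane :: "cpoint set \<Rightarrow> bool" where
  "real_projective_plane R \<longleftrightarrow>
     (\<exists>b :: 3 \<Rightarrow> complex ^ 3. orthonormal_basis b \<and> R = real_points (span (range b)))"

text \<open>The real span carrying \<open>R\<close> is determined by \<open>R\<close> up to a common phase factor, which
  does not affect the resulting sets of points.\<close>

definition closed_geodesic_in :: "cpoint set \<Rightarrow> cpoint set \<Rightarrow> bool" where
  "closed_geodesic_in R \<gamma> \<longleftrightarrow>
     (\<exists>b :: 3 \<Rightarrow> complex ^ 3. orthonormal_basis b \<and> R = real_points (span (range b)) \<and>
       (\<exists>V. subspace V \<and> dim V = 2 \<and> V \<subseteq> span (range b) \<and> \<gamma> = real_points V))"

end

theory Submission
  imports Defs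
begin

text \<open>Choose an orthonormal frame \<open>a\<close> with \<open>A = [a\<^sub>1]\<close>, \<open>A' = [a\<^sub>2]\<close>, \<open>A'' = [a\<^sub>3]\<close>, and with the
  phase of \<open>a\<^sub>3\<close> such that \<open>E = [a\<^sub>2 + a\<^sub>3]\<close>. Then \<open>E' = [a\<^sub>2 + w a\<^sub>3]\<close> and \<open>E'' = [a\<^sub>2 + cnj w a\<^sub>3]\<close>
  for a primitive cube root of unity \<open>w\<close>. The regular tetrahedron on \<open>l\<close> forces
  \<open>X = [a\<^sub>1 + z (a\<^sub>2 + a\<^sub>3)]\<close> with \<open>z\<close> of modulus one, where the three values of \<open>z\<close> differ by
  primitive cube roots of unity. The points \<open>X' = [a\<^sub>1 + z (w a\<^sub>2 + cnj w a\<^sub>3)]\<close> and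
  \<open>X'' = [a\<^sub>1 + z (cnj w a\<^sub>2 + w a\<^sub>3)]\<close> solve the problem. They lie on the geodesics because
  \<open>a\<^sub>1\<close> and \<open>z (w a\<^sub>2 + cnj w a\<^sub>3) = z w (a\<^sub>2 + w a\<^sub>3)\<close> have real Hermitian products with the
  representative \<open>a\<^sub>1 + z (a\<^sub>2 + a\<^sub>3)\<close> of \<open>X\<close>, and mutual unbiasedness reduces to
  \<open>\<bar>1 + 2 t\<bar> = \<bar>1 - t\<bar> = \<surd>3\<close> for a primitive cube root of unity \<open>t\<close>.\<close>


section \<open>The Hermitian form\<close>

lemma herm_add_left: "herm (u + v) w = herm u w + herm v w"
  by (simp add: herm_def distrib_right sum.distrib)

lemma herm_scale_left: "herm (c *s v) w = c * herm v w"
  by (simp add: herm_def sum_distrib_left mult.assoc)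

lemma herm_cnj: "cnj (herm v w) = herm w v"
  by (simp add: herm_def mult.commute)

lemma herm_add_right: "herm u (v + w) = herm u v + herm u w"
  by (simp add: herm_def distrib_left sum.distrib)

lemma herm_scale_right: "herm v (c *s w) = cnj c * herm v w"
  by (simp add: herm_def sum_distrib_left ac_simps)

lemma herm_zero_left [simp]: "herm 0 w = 0"
  by (simp add: herm_def)

lemma herm_zero_right [simp]: "herm v 0 = 0"
  by (simp add: herm_def)

lemmas herm_simps = herm_add_left herm_add_right herm_scale_left herm_scale_right

lemma herm_sum_left: "herm (\<Sum>i\<in>I. f i) w = (\<Sum>i\<in>I. herm (f i) w)"
  by (induction I rule: infinite_finite_induct) (simp_all add: herm_add_left)

lemma herm_self: "herm v v = of_real ((norm v)\<^sup>2)"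
  by (simp add: herm_def norm_vec_def L2_set_def sum_nonneg flip: complex_norm_square)

lemma herm_self_eq_0_iff: "herm v v = 0 \<longleftrightarrow> v = 0"
  by (simp add: herm_self)

lemma cmod_herm_le: "cmod (herm v w) \<le> norm v * norm w"
proof -
  have "cmod (herm v w) \<le> (\<Sum>i\<in>UNIV. \<bar>cmod (v $ i)\<bar> * \<bar>cmod (w $ i)\<bar>)"
    unfolding herm_def by (rule order_trans[OF norm_sum]) (simp add: norm_mult)
  also have "\<dots> \<le> norm v * norm w"
    unfolding norm_vec_def by (rule L2_set_mult_ineq)
  finally show ?thesis .
qed

lemma norm_vector_scale: "norm (c *s v) = cmod c * norm (v :: complex ^ 'n)"
proof -
  have "complex_of_real ((norm (c *s v))\<^sup>2) = of_real ((cmod c * norm v)\<^sup>2)"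
    by (simp only: herm_self[symmetric] power_mult_distrib of_real_mult complex_norm_square)
       (simp add: herm_simps)
  then have "(norm (c *s v))\<^sup>2 = (cmod c * norm v)\<^sup>2"
    by (simp only: of_real_eq_iff)
  then show ?thesis
    by (simp add: power2_eq_iff_nonneg)
qed

lemma of_real_vector_scale: "of_real c *s v = c *\<^sub>R (v :: complex ^ 'n)"
  by (simp add: vec_eq_iff) (simp add: scaleR_conv_of_real)

text \<open>Pairing a vanishing combination with \<open>e j\<close> isolates its \<open>j\<close>-th
  coefficient, so the vectors are independent. Their number equals the dimension, hence spanning
  comes for free.\<close>

lemma orthonormal_basisI:
  assumes "\<And>i j. herm (e i) (e j) = (if i = j then 1 else 0)"
  shows "orthonormal_basis (e :: 'n \<Rightarrow> complex ^ 'n)"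
proof -
  have inj: "inj e"
    by (rule injI) (metis assms zero_neq_one)
  have "vec.independent (range e)"
  proof (rule vec.independent_if_scalars_zero)
    fix f x assume z: "(\<Sum>x\<in>range e. f x *s x) = 0" and "x \<in> range e"
    then obtain j where j: "x = e j" by blast
    have "0 = herm (\<Sum>i\<in>UNIV. f (e i) *s e i) (e j)"
      using z by (simp add: sum.reindex[OF inj])
    also have "\<dots> = (\<Sum>i\<in>UNIV. if i = j then f (e i) else 0)"
      by (simp add: herm_sum_left herm_scale_left assms if_distrib cong: if_cong)
    finally show "f x = 0"
      by (simp add: j)
  qed simp
  moreover have "card (range e) = CARD('n)"
    using inj by (rule card_image)
  ultimately have "UNIV \<subseteq> vec.span (range e)"
    by (intro vec.card_ge_dim_independent)
       (auto simp: vec.dim_UNIV vec.dimension_def card_cart_basis)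
  then show ?thesis
    using assms by (auto simp: orthonormal_basis_def)
qed

section \<open>Real forms: real spans of orthonormal bases\<close>

lemma herm_span_real_right:
  assumes "w \<in> span S" "\<And>x. x \<in> S \<Longrightarrow> herm v x \<in> \<real>"
  shows "herm v w \<in> \<real>"
  using assms(1)
  by (induction rule: span_induct_alt)
     (simp_all add: assms(2) herm_simps flip: of_real_vector_scale)

lemma herm_real_span:
  assumes "orthonormal_basis b" "v \<in> span (range b)" "w \<in> span (range b)"
  shows "herm v w \<in> \<real>"
proof -
  have "herm w (b i) \<in> \<real>" for i
  proof -
    have "herm (b i) w \<in> \<real>"
      using assms(1,3) by (rule_tac herm_span_real_right) (auto simp: orthonormal_basis_def)
    then show ?thesis
      by (metis herm_cnj Reals_cnj_iff)
  qed
  then have "herm w v \<in> \<real>"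
    using assms(2) by (auto intro: herm_span_real_right)
  then show ?thesis
    by (metis herm_cnj Reals_cnj_iff)
qed


section \<open>Points, lines and geodesics\<close>

lemma cline_scale:
  assumes "c \<noteq> 0"
  shows "cline (c *s v) = cline v"
proof
  have "v = (1 / c) *s (c *s v)"
    using assms by (simp add: vector_smult_assoc)
  then have "v \<in> vec.span {c *s v}"
    by (metis insertI1 vec.span_base vec.span_scale)
  then show "cline v \<subseteq> cline (c *s v)"
    unfolding cline_def by (simp add: vec.span_minimal)
  show "cline (c *s v) \<subseteq> cline v"
    unfolding cline_def by (simp add: vec.span_minimal vec.span_base vec.span_scale)
qed

lemma cline_eqD:
  assumes "cline v = cline w" "w \<noteq> 0"
  obtains c where "c \<noteq> 0" "w = c *s v"
proof -
  have "w \<in> cline v"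
    unfolding assms(1) by (simp add: cline_def vec.span_base)
  then obtain c where "w = c *s v"
    unfolding cline_def vec.span_singleton by auto
  with assms(2) that show thesis by (cases "c = 0") auto
qed

lemma CP2E:
  assumes "P \<in> CP2"
  obtains v where "norm v = 1" "P = cline v"
proof -
  have P: "vec.subspace P" "vec.dim P = 1"
    using assms by (auto simp: CP2_def)
  obtain S where S: "S \<subseteq> P" "vec.independent S" "P \<subseteq> vec.span S" "card S = vec.dim P"
    using vec.basis_exists by blast
  then obtain v where v: "S = {v}"
    using P by (auto simp: card_1_singleton_iff)
  have "v \<noteq> 0"
    using S(2) v vec.dependent_zero by blast
  moreover have "P = cline v"
    using S P(1) vec.span_subspace unfolding v cline_def by blast
  ultimately show thesis
    using that[of "of_real (1 / norm v) *s v"]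
    by (simp add: cline_scale norm_vector_scale norm_divide)
qed

lemma cline_in_CP2: "v \<noteq> 0 \<Longrightarrow> cline v \<in> CP2"
  by (auto simp: CP2_def cline_def vec.dim_eq_card_independent vec.independent_insert)

text \<open>Well-definedness of the \<open>THE\<close> term: a unit vector of \<open>cline v\<close>
  is \<open>c *s v\<close> with \<open>cmod c = 1 / norm v\<close>, and the modulus of the product
  depends on \<open>c\<close> only through \<open>cmod c\<close>.\<close>

lemma fs_dist_cline:
  assumes "v \<noteq> 0" "w \<noteq> 0"
  shows "fs_dist (cline v) (cline w) = 2 * arccos (cmod (herm v w) / (norm v * norm w))"
  unfolding fs_dist_def
proof (rule the_equality)
  have unit: "of_real (1 / norm u) *s u \<in> cline u" "norm (of_real (1 / norm u) *s u) = 1"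
    if "u \<noteq> 0" for u
    using that by (simp_all add: cline_def vec.span_base vec.span_scale norm_vector_scale norm_divide)
  show "\<exists>v'\<in>cline v. \<exists>w'\<in>cline w. norm v' = 1 \<and> norm w' = 1 \<and>
      2 * arccos (cmod (herm v w) / (norm v * norm w)) = 2 * arccos (cmod (herm v' w'))"
    using assms
    by (intro bexI[OF _ unit(1)] conjI unit(2)) (auto simp: herm_simps norm_mult norm_divide mult.commute)
next
  fix d assume "\<exists>v'\<in>cline v. \<exists>w'\<in>cline w. norm v' = 1 \<and> norm w' = 1 \<and>
      d = 2 * arccos (cmod (herm v' w'))"
  then obtain c c' where "cmod c * norm v = 1" "cmod c' * norm w = 1"
    "d = 2 * arccos (cmod (herm (c *s v) (c' *s w)))"
    by (auto simp: cline_def vec.span_singleton norm_vector_scale)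
  moreover from this have "cmod c = 1 / norm v" "cmod c' = 1 / norm w"
    using assms by (simp_all add: field_simps)
  ultimately show "d = 2 * arccos (cmod (herm v w) / (norm v * norm w))"
    by (simp add: herm_simps norm_mult mult.commute)
qed

text \<open>Cauchy-Schwarz puts the quotient into the domain of \<open>arccos\<close>. This cosine
  turns the distance conditions of the configuration into algebraic equations.\<close>

lemma cos_half_fs_dist:
  assumes "v \<noteq> 0" "w \<noteq> 0"
  shows "cos (fs_dist (cline v) (cline w) / 2) = cmod (herm v w) / (norm v * norm w)"
proof -
  have "-1 \<le> cmod (herm v w) / (norm v * norm w)" "cmod (herm v w) / (norm v * norm w) \<le> 1"
    using assms cmod_herm_le[of v w] by (auto simp: divide_le_eq intro: order_trans[of _ 0])
  then show ?thesis
    using assms by (simp add: fs_dist_cline cos_arccos del: divide_le_eq_1)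
qed

text \<open>Orthogonal nonzero vectors are independent, so \<open>u\<close> and \<open>v\<close>
  span the two-dimensional space underlying \<open>l\<close>.\<close>

lemma complex_projective_lineD:
  assumes "complex_projective_line l" "cline u \<in> l" "cline v \<in> l"
    and "u \<noteq> 0" "v \<noteq> 0" "herm u v = 0" and "P \<in> l"
  obtains p q where "norm (p *s u + q *s v) = 1" "P = cline (p *s u + q *s v)"
proof -
  obtain W where W: "vec.subspace W" "vec.dim W = 2" "l = {P \<in> CP2. P \<subseteq> W}"
    using assms(1) by (auto simp: complex_projective_line_def)
  have in_W: "x \<in> W" if "cline x \<in> l" for x
    using that W(3) by (auto simp: cline_def intro: vec.span_base)
  have "v \<notin> vec.span {u}"
    using assms(4-6) by (auto simp: vec.span_singleton herm_simps herm_self_eq_0_iff)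
  moreover from this have "v \<noteq> u"
    using vec.span_base by blast
  ultimately have "W \<subseteq> vec.span {v, u}"
    using W(2) assms(2-4) in_W
    by (intro vec.card_ge_dim_independent) (auto simp: vec.independent_insert)
  obtain x where x: "norm x = 1" "P = cline x"
    using assms(7) W(3) by (auto elim: CP2E)
  then have "x \<in> vec.span {v, u}"
    using \<open>W \<subseteq> _\<close> in_W assms(7) by blast
  then obtain q p where "x - q *s v = p *s u"
    by (auto simp: vec.span_insert vec.span_singleton)
  then have "x = p *s u + q *s v"
    by (simp add: algebra_simps)
  with x that show thesis by blast
qed

text \<open>All Hermitian products in a real form are real. Hence a representative of \<open>x\<close> in the
  real form fixes the phases of the representatives of \<open>u\<close> and \<open>v\<close>: they are real multiples of
  \<open>herm x u *s u\<close> and \<open>herm x v *s v\<close>, up to one common factor.\<close>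

lemma real_combination_in_geodesic:
  assumes geo: "closed_geodesic_in R \<gamma>" and "cline u \<in> \<gamma>" "cline v \<in> \<gamma>" and "cline x \<in> R"
    and y: "y = (of_real s * herm x u) *s u + (of_real t * herm x v) *s v" "y \<noteq> 0"
  shows "cline y \<in> \<gamma>"
proof -
  obtain b V where b: "orthonormal_basis b" "R = real_points (span (range b))"
    and V: "subspace V" "V \<subseteq> span (range b)" "\<gamma> = real_points V"
    using geo unfolding closed_geodesic_in_def by blast
  have rep: "\<exists>c. c \<noteq> 0 \<and> c *s u \<in> U" if "cline u \<in> real_points U" for u U
    using that unfolding real_points_def by (auto elim!: cline_eqD)
  obtain n where n: "n \<noteq> 0" "n *s x \<in> span (range b)"
    using rep assms(4) b by blast
  have *: "(of_real s * (n * herm x u)) *s u \<in> V" if "cline u \<in> \<gamma>" for u and s :: real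
  proof -
    obtain l where l: "l \<noteq> 0" "l *s u \<in> V"
      using rep \<open>cline u \<in> \<gamma>\<close> V by blast
    have "herm (n *s x) (l *s u) \<in> \<real>"
      using herm_real_span[OF b(1) n(2)] l V by blast
    then obtain r where r: "n * cnj l * herm x u = of_real r"
      by (auto simp: herm_simps ac_simps elim: Reals_cases)
    \<comment> \<open>Multiplying \<open>r\<close> by \<open>l\<close> and dividing by
      \<open>l * cnj l\<close> exhibits the coefficient as a real multiple of \<open>l\<close>,
      while \<open>l *s u\<close> already lies in \<open>V\<close>.\<close>
    have "of_real s * (n * herm x u) = of_real (s * r / (cmod l)\<^sup>2) * l"
      using l unfolding of_real_divide of_real_mult r[symmetric] complex_norm_square
      by (simp add: field_simps)
    then have "(of_real s * (n * herm x u)) *s u = (s * r / (cmod l)\<^sup>2) *\<^sub>R (l *s u)"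
      by (metis of_real_vector_scale vector_smult_assoc)
    then show ?thesis
      using l V(1) by (simp add: subspace_scale)
  qed
  have "n *s y = (of_real s * (n * herm x u)) *s u + (of_real t * (n * herm x v)) *s v"
    by (simp add: y algebra_simps)
  then have "n *s y \<in> V"
    using * assms(2,3) V(1) by (simp add: subspace_add)
  moreover have "n *s y \<noteq> 0"
    using n y(2) by simp
  ultimately have "cline (n *s y) \<in> \<gamma>"
    unfolding V(3) real_points_def by blast
  then show ?thesis
    using n by (simp add: cline_scale)
qed

lemma closed_geodesic_in_subset: "closed_geodesic_in R \<gamma> \<Longrightarrow> \<gamma> \<subseteq> R"
  unfolding closed_geodesic_in_def real_points_def by blast

section \<open>Passage between orthonormal frames and bases of points\<close>

lemma mutually_unbiased_sym: "mutually_unbiased e f \<Longrightarrow> mutually_unbiased f e"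
  unfolding mutually_unbiased_def by (metis complex_mod_cnj herm_cnj)

lemma complete_MUB_systemI:
  assumes "length es = CARD('n) + 1" "\<forall>e\<in>set es. orthonormal_basis e"
    and "sorted_wrt mutually_unbiased es"
  shows "complete_MUB_system (es :: ('n \<Rightarrow> complex ^ 'n) list)"
  using assms unfolding complete_MUB_system_def sorted_wrt_iff_nth_less
  by (metis linorder_neqE_nat mutually_unbiased_sym)

lemma cline_eq_iff_orthonormal:
  assumes "orthonormal_basis e"
  shows "cline (e i) = cline (e j) \<longleftrightarrow> i = j"
proof
  assume "cline (e i) = cline (e j)"
  moreover have *: "herm (e i) (e j) = (if i = j then 1 else 0)" for i j
    using assms by (simp add: orthonormal_basis_def)
  have "e j \<noteq> 0"
    using *[of j j] by auto
  ultimately obtain c where "c \<noteq> 0" "e j = c *s e i"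
    by (rule cline_eqD)
  then have "herm (e j) (e i) \<noteq> 0"
    by (simp add: herm_simps *)
  then show "i = j"
    by (simp add: * split: if_splits)
qed simp

text \<open>Orthogonality gives \<open>arccos 0 = pi / 2\<close>, hence distance \<open>pi\<close>;
  bases of points can therefore be verified on vectors.\<close>

lemma represents_cp_basis:
  assumes "represents e S"
  shows "cp_basis S"
proof -
  have e: "orthonormal_basis e" "S = range (\<lambda>i. cline (e i))"
    using assms by (auto simp: represents_def)
  have nz: "e i \<noteq> 0" for i
    using e(1) by (metis herm_zero_left orthonormal_basis_def zero_neq_one)
  have "card S = 3"
    unfolding e(2) by (subst card_image) (auto intro!: injI simp: cline_eq_iff_orthonormal[OF e(1)])
  moreover have "pairwise (\<lambda>P Q. fs_dist P Q = pi) S"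
  proof (rule pairwiseI)
    fix P Q assume "P \<in> S" "Q \<in> S" "P \<noteq> Q"
    then obtain i j where "P = cline (e i)" "Q = cline (e j)" "i \<noteq> j"
      using e(2) by auto
    then show "fs_dist P Q = pi"
      using e(1) nz by (simp add: fs_dist_cline orthonormal_basis_def)
  qed
  ultimately show ?thesis
    unfolding cp_basis_def by (auto simp: e(2) nz cline_in_CP2)
qed

lemma cp_mutually_unbiasedI:
  "\<lbrakk>represents e S; represents f T; mutually_unbiased e f\<rbrakk> \<Longrightarrow> cp_mutually_unbiased S T"
  unfolding cp_mutually_unbiased_def using represents_cp_basis by blast

lemma cp_basisE:
  assumes "cp_basis {A, A', A''}" "distinct [A, A', A'']"
  obtains a where "orthonormal_basis a" "A = cline (a 1)" "A' = cline (a 2)" "A'' = cline (a 3)"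
proof -
  have cp: "A \<in> CP2" "A' \<in> CP2" "A'' \<in> CP2"
    and d: "pairwise (\<lambda>P Q. fs_dist P Q = pi) {A, A', A''}"
    using assms(1) by (auto simp: cp_basis_def)
  obtain u v w where u: "norm u = 1" "A = cline u" and v: "norm v = 1" "A' = cline v"
    and w: "norm w = 1" "A'' = cline w"
    using cp by (metis CP2E)
  have orth: "herm x y = 0" if "norm x = 1" "norm y = 1" "fs_dist (cline x) (cline y) = pi"
    for x y :: "complex ^ 3"
    using cos_half_fs_dist[of x y] that by (cases "x = 0"; cases "y = 0") auto
  define a where "a = (\<lambda>i::3. if i = 1 then u else if i = 2 then v else w)"
  have "herm u v = 0" "herm u w = 0" "herm v w = 0" "herm v u = 0" "herm w u = 0" "herm w v = 0"
    using d assms(2) u v w by (auto intro!: orth simp: pairwise_def)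
  then have "herm (a i) (a j) = (if i = j then 1 else 0)" for i j
    using u v w exhaust_3[of i] exhaust_3[of j] by (auto simp: a_def herm_self)
  then have "orthonormal_basis a"
    by (rule orthonormal_basisI)
  then show thesis
    by (rule that) (auto simp: a_def u v w)
qed


section \<open>Coordinates in an orthonormal frame\<close>

definition comb :: "(3 \<Rightarrow> complex ^ 3) \<Rightarrow> complex \<Rightarrow> complex \<Rightarrow> complex \<Rightarrow> complex ^ 3" where
  "comb a p q r = p *s a 1 + q *s a 2 + r *s a 3"

lemma comb_add: "comb a p q r + comb a p' q' r' = comb a (p + p') (q + q') (r + r')"
  by (simp add: comb_def algebra_simps)

lemma comb_scale: "c *s comb a p q r = comb a (c * p) (c * q) (c * r)"
  by (simp add: comb_def algebra_simps)

lemma comb_axis: "a 1 = comb a 1 0 0" "a 2 = comb a 0 1 0" "a 3 = comb a 0 0 1"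
  by (simp_all add: comb_def)

context
  fixes a :: "3 \<Rightarrow> complex ^ 3"
  assumes a: "orthonormal_basis a"
begin

lemma herm_comb: "herm (comb a p q r) (comb a p' q' r') = p * cnj p' + q * cnj q' + r * cnj r'"
proof -
  have "herm (a i) (a j) = (if i = j then 1 else 0)" for i j
    using a by (simp add: orthonormal_basis_def)
  then show ?thesis
    by (simp add: comb_def herm_simps)
qed

lemma norm_comb: "norm (comb a p q r) = sqrt ((cmod p)\<^sup>2 + (cmod q)\<^sup>2 + (cmod r)\<^sup>2)"
proof -
  have "complex_of_real ((norm (comb a p q r))\<^sup>2) =
      of_real ((cmod p)\<^sup>2 + (cmod q)\<^sup>2 + (cmod r)\<^sup>2)"
    by (simp only: herm_self[symmetric] herm_comb of_real_add complex_norm_square)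
  then have "(norm (comb a p q r))\<^sup>2 = (cmod p)\<^sup>2 + (cmod q)\<^sup>2 + (cmod r)\<^sup>2"
    by (simp only: of_real_eq_iff)
  then show ?thesis
    by (metis norm_ge_zero real_sqrt_unique)
qed

lemma comb_eq_0_iff: "comb a p q r = 0 \<longleftrightarrow> p = 0 \<and> q = 0 \<and> r = 0"
proof -
  have "comb a p q r = 0 \<longleftrightarrow> (cmod p)\<^sup>2 + (cmod q)\<^sup>2 + (cmod r)\<^sup>2 = 0"
    by (subst norm_eq_zero[symmetric]) (simp add: norm_comb del: norm_eq_zero)
  then show ?thesis
    by (simp add: add_nonneg_eq_0_iff)
qed

lemma cos_half_dist_comb:
  assumes "(p, q, r) \<noteq> (0, 0, 0)" "(p', q', r') \<noteq> (0, 0, 0)"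
  shows "cos (fs_dist (cline (comb a p q r)) (cline (comb a p' q' r')) / 2) =
    cmod (p * cnj p' + q * cnj q' + r * cnj r') /
    (sqrt ((cmod p)\<^sup>2 + (cmod q)\<^sup>2 + (cmod r)\<^sup>2) * sqrt ((cmod p')\<^sup>2 + (cmod q')\<^sup>2 + (cmod r')\<^sup>2))"
  using assms by (subst cos_half_fs_dist) (auto simp: comb_eq_0_iff herm_comb norm_comb)

text \<open>For a unit vector with coordinates \<open>p\<close>, \<open>q\<close> the cosines of the
  half distances to the two axes are \<open>cmod p\<close> and \<open>cmod q\<close>. Equidistance
  makes these equal, and dividing by \<open>p\<close> leaves a phase.\<close>

lemma equidistant_circle:
  assumes "complex_projective_line m" "cline (a 2) \<in> m" "cline (a 3) \<in> m"
    and "P \<in> m" "fs_dist P (cline (a 2)) = fs_dist P (cline (a 3))"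
  obtains w where "cmod w = 1" "P = cline (comb a 0 1 w)"
proof -
  have "a 2 \<noteq> 0" "a 3 \<noteq> 0" "herm (a 2) (a 3) = 0"
    by (simp_all add: comb_axis[of a] comb_eq_0_iff herm_comb)
  then obtain p q where pq: "norm (p *s a 2 + q *s a 3) = 1" "P = cline (p *s a 2 + q *s a 3)"
    by (rule complex_projective_lineD[OF assms(1-3) _ _ _ assms(4)])
  have eq: "p *s a 2 + q *s a 3 = comb a 0 p q"
    by (simp add: comb_def)
  have n: "(cmod p)\<^sup>2 + (cmod q)\<^sup>2 = 1"
    using pq(1) by (simp add: eq norm_comb)
  then have "p \<noteq> 0 \<or> q \<noteq> 0"
    by auto
  then have "cmod p = cmod q"
    using arg_cong[OF assms(5), of "\<lambda>x. cos (x / 2)"] n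
    unfolding pq(2)[unfolded eq] comb_axis(2,3)[of a] by (simp add: cos_half_dist_comb)
  moreover from this have "p \<noteq> 0"
    using \<open>p \<noteq> 0 \<or> q \<noteq> 0\<close> by auto
  moreover from this have "P = cline (comb a 0 1 (q / p))"
    using pq(2) cline_scale[of p "comb a 0 1 (q / p)"] by (simp add: eq comb_scale)
  ultimately show thesis
    by (intro that[of "q / p"]) (auto simp: norm_divide)
qed

text \<open>Dividing by the coefficient of \<open>a 1\<close>, which vanishes only at the excluded
  point, gives an affine coordinate on \<open>l\<close> with \<open>cline (a 1)\<close> at 0 and the
  excluded point at infinity.\<close>

lemma points_on_line:
  assumes "complex_projective_line l" "cline (a 1) \<in> l" "cline (comb a 0 1 1) \<in> l"
    and "P \<in> l" "P \<noteq> cline (comb a 0 1 1)"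
  obtains z where "P = cline (comb a 1 z z)"
proof -
  have "a 1 \<noteq> 0" "comb a 0 1 1 \<noteq> 0" "herm (a 1) (comb a 0 1 1) = 0"
    by (simp_all add: comb_axis(1)[of a] comb_eq_0_iff herm_comb)
  then obtain p q where pq: "norm (p *s a 1 + q *s comb a 0 1 1) = 1"
    "P = cline (p *s a 1 + q *s comb a 0 1 1)"
    by (rule complex_projective_lineD[OF assms(1-3) _ _ _ assms(4)])
  have eq: "p *s a 1 + q *s comb a 0 1 1 = comb a p q q"
    by (simp add: comb_def algebra_simps)
  have "p \<noteq> 0"
  proof
    assume "p = 0"
    then have "q \<noteq> 0"
      using pq(1) by auto
    then have "P = cline (comb a 0 1 1)"
      using pq(2) \<open>p = 0\<close> by (simp add: cline_scale)
    with assms(5) show False ..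
  qed
  then have "P = cline (comb a 1 (q / p) (q / p))"
    using pq(2)[unfolded eq] cline_scale[of p "comb a 1 (q / p) (q / p)"] by (simp add: comb_scale)
  then show thesis ..
qed

end

lemma orthonormal_basis_rephase:
  assumes "orthonormal_basis a" "cmod w = 1"
  shows "orthonormal_basis (a(k := w *s a k))"
proof (rule orthonormal_basisI)
  have "w * cnj w = 1" "cnj w * w = 1"
    using assms(2) by (simp_all add: mult.commute flip: complex_norm_square)
  then show "herm ((a(k := w *s a k)) i) ((a(k := w *s a k)) j) = (if i = j then 1 else 0)" for i j
    using assms(1) by (auto simp: orthonormal_basis_def herm_simps mult.assoc[symmetric])
qed


section \<open>Cube roots of unity\<close>

text \<open>Subtracting \<open>(cmod t)\<^sup>2 = 1\<close> from
  \<open>(cmod (1 + t))\<^sup>2 = 1\<close> leaves \<open>1 + 2 * Re t = 0\<close>. Modulus 1 and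
  real part -1/2 are the form in which primitive cube roots of unity are handled below.\<close>

lemma Re_eq_minus_half:
  assumes "cmod t = 1" "cmod (1 + t) = 1"
  shows "Re t = - 1 / 2"
proof -
  have "(Re t)\<^sup>2 + (Im t)\<^sup>2 = 1" "(1 + Re t)\<^sup>2 + (Im t)\<^sup>2 = 1"
    using assms by (simp_all add: cmod_def)
  then show ?thesis
    by (simp add: power2_eq_square algebra_simps)
qed

lemma cnj_eqI:
  assumes "cmod w = cmod w'" "Re w = Re w'" "w \<noteq> w'"
  shows "w' = cnj w"
proof -
  have "(Im w)\<^sup>2 = (Im w')\<^sup>2"
    using assms by (simp add: cmod_def)
  then show ?thesis
    using assms by (auto simp: complex_eq_iff power2_eq_iff)
qed

text \<open>The Gram determinant of three vectors in the plane vanishes.\<close>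

lemma equal_gram_plane:
  fixes u v w :: complex
  assumes "(cmod u)\<^sup>2 = r" "(cmod v)\<^sup>2 = r" "(cmod w)\<^sup>2 = r"
    and "Re (u * cnj v) = d" "Re (u * cnj w) = d" "Re (v * cnj w) = d" and "u \<noteq> v"
  shows "r + 2 * d = 0" "r \<noteq> 0"
proof -
  have "(cmod (u - v))\<^sup>2 = 2 * (r - d)"
    using assms(1,2,4) by (simp add: cmod_power2) (simp add: power2_eq_square algebra_simps)
  then have "r \<noteq> d"
    using assms(7) by auto
  have "(cmod u)\<^sup>2 * (cmod v)\<^sup>2 * (cmod w)\<^sup>2
      + 2 * Re (u * cnj v) * Re (u * cnj w) * Re (v * cnj w)
      - (cmod u)\<^sup>2 * (Re (v * cnj w))\<^sup>2 - (cmod v)\<^sup>2 * (Re (u * cnj w))\<^sup>2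
      - (cmod w)\<^sup>2 * (Re (u * cnj v))\<^sup>2 = 0"
    unfolding cmod_power2 by simp algebra
  \<comment> \<open>The determinant of the matrix with diagonal \<open>r\<close> and all other
    entries \<open>d\<close> factors this way; \<open>r = d\<close> would force
    \<open>u = v\<close>.\<close>
  then have "(r - d) * (r - d) * (r + 2 * d) = 0"
    unfolding assms(1-6) by algebra
  then show "r + 2 * d = 0"
    using \<open>r \<noteq> d\<close> by auto
  then show "r \<noteq> 0"
    using \<open>r \<noteq> d\<close> by auto
qed

text \<open>The squared modulus is \<open>1 - k + k\<^sup>2\<close>, which is 3 for both values of
  \<open>k\<close>. These values are \<open>2 * Re s\<close>, where \<open>s\<close> is a quotient
  of two cube roots of unity.\<close>

lemma cmod_one_plus_scaled_root:
  assumes "cmod t = 1" "Re t = - 1 / 2" "k \<in> {2, - 1}"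
  shows "cmod (1 + t * of_real k) = sqrt 3"
proof -
  have "(Re t)\<^sup>2 + (Im t)\<^sup>2 = 1"
    using assms(1) by (simp add: cmod_def)
  then have "(Im t)\<^sup>2 = 3 / 4"
    using assms(2) by (simp add: power2_eq_square)
  then have "(1 + Re t * k)\<^sup>2 + (Im t * k)\<^sup>2 = 3"
    using assms(2,3) by (auto simp: power_mult_distrib power2_eq_square)
  then show ?thesis
    by (simp add: cmod_def)
qed


section \<open>The four bases\<close>

definition croot :: "complex \<Rightarrow> 3 \<Rightarrow> complex" where
  "croot w i = (if i = 1 then 1 else if i = 2 then w else cnj w)"

text \<open>For a primitive cube root \<open>w\<close> and a phase \<open>z\<close> this is the
  Fourier basis with its last two coordinates multiplied by \<open>z\<close>. Conjugate roots in
  these coordinates make their contributions to a product add up to a real multiple of one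
  phase.\<close>

definition mub :: "(3 \<Rightarrow> complex ^ 3) \<Rightarrow> complex \<Rightarrow> complex \<Rightarrow> 3 \<Rightarrow> complex ^ 3" where
  "mub a w z i = of_real (1 / sqrt 3) *s comb a 1 (z * croot w i) (z * cnj (croot w i))"

context
  fixes w :: complex
  assumes w: "cmod w = 1" "Re w = - 1 / 2"
begin

lemma w_mult_cnj: "w * cnj w = 1"
  using w(1) by (simp flip: complex_norm_square)

lemma w_square: "w * w = cnj w"
proof -
  have "w + cnj w = - 1"
    using w(2) by (simp add: complex_eq_iff)
  with w_mult_cnj show ?thesis by algebra
qed

lemma one_plus_w: "1 + w = - cnj w"
  using w(2) by (simp add: complex_eq_iff)

lemma cmod_croot: "cmod (croot w i) = 1"
  by (simp add: croot_def w)

lemma Re_croot: "Re (croot w i * cnj (croot w j)) = (if i = j then 1 else - 1 / 2)"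
proof -
  have "cnj w * w = 1" "cnj w * cnj w = w"
    using w_mult_cnj w_square by (auto simp: mult.commute simp flip: complex_cnj_mult)
  then show ?thesis
    using exhaust_3[of i] exhaust_3[of j] w(2) by (auto simp: croot_def w_mult_cnj w_square simp del: times_complex.sel)
qed

lemma herm_mub:
  assumes "orthonormal_basis a"
  shows "herm (mub a w z i) (mub a w z' j) =
    (1 + z * cnj z' * of_real (2 * Re (croot w i * cnj (croot w j)))) / 3"
proof -
  have "complex_of_real (1 / sqrt 3) * cnj (of_real (1 / sqrt 3)) = 1 / 3"
    by (simp flip: of_real_mult)
  moreover have "1 * cnj 1 + z * croot w i * cnj (z' * croot w j) +
      z * cnj (croot w i) * cnj (z' * cnj (croot w j)) =
      1 + z * cnj z' * (croot w i * cnj (croot w j) + cnj (croot w i * cnj (croot w j)))"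
    by (simp add: algebra_simps)
  moreover have "herm (mub a w z i) (mub a w z' j) =
      (complex_of_real (1 / sqrt 3) * cnj (of_real (1 / sqrt 3))) *
      herm (comb a 1 (z * croot w i) (z * cnj (croot w i)))
        (comb a 1 (z' * croot w j) (z' * cnj (croot w j)))"
    by (simp only: mub_def herm_scale_left herm_scale_right ac_simps)
  ultimately show ?thesis
    by (simp only: herm_comb[OF assms] complex_add_cnj) simp
qed

text \<open>With \<open>z' = z\<close> the product is \<open>(1 + 2) / 3\<close> on the diagonal and
  \<open>(1 - 1) / 3\<close> off it.\<close>

lemma orthonormal_basis_mub:
  assumes "orthonormal_basis a" "cmod z = 1"
  shows "orthonormal_basis (mub a w z)"
  using assms by (intro orthonormal_basisI)
    (simp add: herm_mub Re_croot flip: complex_norm_square del: times_complex.sel)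

lemma mutually_unbiased_mub:
  assumes "orthonormal_basis a" "cmod z = 1" "cmod z' = 1" "Re (z * cnj z') = - 1 / 2"
  shows "mutually_unbiased (mub a w z) (mub a w z')"
proof -
  \<comment> \<open>The phase \<open>z * cnj z'\<close> is a primitive cube root, and its real
    factor is 2 if \<open>i = j\<close> and -1 otherwise.\<close>
  have "cmod (herm (mub a w z i) (mub a w z' j)) = sqrt 3 / 3" for i j
    unfolding herm_mub[OF assms(1)] norm_divide
    by (subst cmod_one_plus_scaled_root) (use assms in \<open>auto simp: norm_mult Re_croot simp del: times_complex.sel\<close>)
  then have "\<exists>c. \<forall>i j. cmod (herm (mub a w z i) (mub a w z' j)) = c"
    by blast
  then show ?thesis
    using assms orthonormal_basis_mub by (simp add: mutually_unbiased_def)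
qed

text \<open>Every coordinate of every vector \<open>mub a w z j\<close> has modulus
  \<open>1 / sqrt 3\<close>.\<close>

lemma mutually_unbiased_frame_mub:
  assumes "orthonormal_basis a" "cmod z = 1"
  shows "mutually_unbiased a (mub a w z)"
proof -
  have "cmod (herm (a i) (mub a w z j)) = 1 / sqrt 3" for i j
    using exhaust_3[of i] assms
    by (auto simp: mub_def comb_axis[of a] herm_simps herm_comb norm_mult norm_divide cmod_croot)
  then show ?thesis
    using assms orthonormal_basis_mub by (auto simp: mutually_unbiased_def)
qed

lemma represents_mub:
  assumes "orthonormal_basis a" "cmod z = 1"
  shows "represents (mub a w z) {cline (comb a 1 z z), cline (comb a 1 (z * w) (z * cnj w)),
    cline (comb a 1 (z * cnj w) (z * w))}"
proof -
  have "cline (mub a w z i) = cline (comb a 1 (z * croot w i) (z * cnj (croot w i)))" for i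
    unfolding mub_def by (rule cline_scale) simp
  then show ?thesis
    using orthonormal_basis_mub[OF assms] unfolding represents_def UNIV_3
    by (simp add: croot_def)
qed

text \<open>The new point is \<open>[a 1 - 2 *s y]\<close>, where \<open>y\<close> is the orthogonal projection of
  \<open>comb a 1 z z\<close> to the line of \<open>comb a 0 1 w\<close>.\<close>

lemma mub_point_in_geodesic:
  assumes "orthonormal_basis a" "closed_geodesic_in R \<gamma>" "cline (a 1) \<in> \<gamma>"
    and "cline (comb a 0 1 w) \<in> \<gamma>" "cline (comb a 1 z z) \<in> R"
  shows "cline (comb a 1 (z * w) (z * cnj w)) \<in> \<gamma>"
proof (rule real_combination_in_geodesic[OF assms(2-5)])
  \<comment> \<open>The left side is the product of \<open>comb a 1 z z\<close> with
    \<open>comb a 0 1 w\<close>, so the real coefficients 1 and -1 produce the required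
    vector.\<close>
  have "z + z * cnj w = - (z * w)"
    using arg_cong[OF one_plus_w, of "\<lambda>t. z * cnj t"] by (simp add: algebra_simps)
  then show "comb a 1 (z * w) (z * cnj w) =
      (of_real 1 * herm (comb a 1 z z) (a 1)) *s a 1 +
      (of_real (- 1) * herm (comb a 1 z z) (comb a 0 1 w)) *s comb a 0 1 w"
    by (simp add: comb_axis(1)[of a] herm_comb[OF assms(1)] comb_scale comb_add mult.assoc w_square)
  show "comb a 1 (z * w) (z * cnj w) \<noteq> 0"
    by (simp add: comb_eq_0_iff[OF assms(1)])
qed

end


section \<open>The configuration\<close>

text \<open>Replacing \<open>a 3\<close> by \<open>u *s a 3\<close> keeps its point and divides the
  circle coordinate by \<open>u\<close>, which moves \<open>E\<close> to coordinate 1.\<close>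

lemma circle_frame:
  assumes "orthonormal_basis a" "complex_projective_line m" "cline (a 2) \<in> m" "cline (a 3) \<in> m"
    and S1: "S1 = {P \<in> m. fs_dist P (cline (a 2)) = fs_dist P (cline (a 3))}" and "E \<in> S1"
  obtains a' where "orthonormal_basis a'" "a' 1 = a 1" "a' 2 = a 2" "cline (a' 3) = cline (a 3)"
    and "E = cline (comb a' 0 1 1)"
    and "\<forall>P\<in>S1. \<exists>w. cmod w = 1 \<and> P = cline (comb a' 0 1 w)"
proof -
  have *: "\<exists>w. cmod w = 1 \<and> P = cline (comb a 0 1 w)" if "P \<in> S1" for P
    using that S1 equidistant_circle[OF assms(1-4), of P] by blast
  obtain u where u: "cmod u = 1" "E = cline (comb a 0 1 u)"
    using *[OF \<open>E \<in> S1\<close>] by blast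
  define a' where "a' = a(3 := u *s a 3)"
  have "u \<noteq> 0"
    using u by auto
  then have comb: "comb a 0 1 t = comb a' 0 1 (t / u)" for t
    by (simp add: comb_def a'_def)
  show thesis
  proof (rule that)
    show "orthonormal_basis a'"
      unfolding a'_def using assms(1) u(1) by (rule orthonormal_basis_rephase)
    show "\<forall>P\<in>S1. \<exists>w. cmod w = 1 \<and> P = cline (comb a' 0 1 w)"
      using * u(1) unfolding comb by (metis div_by_1 norm_divide)
    show "E = cline (comb a' 0 1 1)"
      using u \<open>u \<noteq> 0\<close> by (simp add: comb)
  qed (use \<open>u \<noteq> 0\<close> in \<open>auto simp: a'_def cline_scale\<close>)
qed

text \<open>The half distance \<open>pi / 3\<close> has cosine 1/2, so
  \<open>cmod (1 + u * cnj v) = 1\<close> for any two vertices. Thus \<open>w\<close> and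
  \<open>w'\<close> both have real part -1/2, and being distinct they are conjugate.\<close>

lemma equilateral_triangle_on_circle:
  assumes a: "orthonormal_basis a" and "cmod w = 1" "cmod w' = 1"
    and "fs_dist (cline (comb a 0 1 1)) (cline (comb a 0 1 w)) = 2 * pi / 3"
    and "fs_dist (cline (comb a 0 1 w)) (cline (comb a 0 1 w')) = 2 * pi / 3"
    and "fs_dist (cline (comb a 0 1 1)) (cline (comb a 0 1 w')) = 2 * pi / 3"
  shows "Re w = - 1 / 2" "w' = cnj w"
proof -
  have *: "Re (u * cnj v) = - 1 / 2"
    if "cmod u = 1" "cmod v = 1"
      "fs_dist (cline (comb a 0 1 u)) (cline (comb a 0 1 v)) = 2 * pi / 3" for u v
  proof (rule Re_eq_minus_half)
    show "cmod (u * cnj v) = 1"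
      using that by (simp add: norm_mult)
    have "cos (2 * pi / 3 / 2) = cmod (1 + u * cnj v) / 2"
      unfolding that(3)[symmetric] using that(1,2) by (subst cos_half_dist_comb[OF a]) auto
    then show "cmod (1 + u * cnj v) = 1"
      by (simp add: cos_60)
  qed
  have "Re (1 * cnj w) = - 1 / 2" "Re (1 * cnj w') = - 1 / 2" "Re (w * cnj w') = - 1 / 2"
    using *[of 1 w] *[of 1 w'] *[of w w'] assms by (simp_all del: times_complex.sel)
  moreover have "Re (w * cnj w) = 1"
    using assms(2) by (simp add: cmod_def power2_eq_square)
  ultimately show "Re w = - 1 / 2" "w' = cnj w"
    using assms(2,3) by (auto intro!: cnj_eqI simp del: times_complex.sel)
qed

text \<open>In the affine coordinate on \<open>l\<close>, equal distances to
  \<open>cline (a 1)\<close> give equal moduli, and equal mutual distances give equal real inner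
  products. The vanishing Gram determinant then forces modulus 1.\<close>

lemma regular_tetrahedron_on_line:
  assumes a: "orthonormal_basis a"
    and l: "complex_projective_line l" "cline (a 1) \<in> l" "cline (comb a 0 1 1) \<in> l"
    and "B \<in> l" "C \<in> l" "D \<in> l"
    and dist: "distinct [cline (a 1), B, C, D]" and equi: "equidistant {cline (a 1), B, C, D}"
  obtains z where "\<forall>X\<in>{B, C, D}. cmod (z X) = 1 \<and> X = cline (comb a 1 (z X) (z X))"
    and "\<forall>X\<in>{B, C, D}. \<forall>Y\<in>{B, C, D}. X \<noteq> Y \<longrightarrow> Re (z X * cnj (z Y)) = - 1 / 2"
proof -
  let ?T = "{B, C, D}"
  obtain r where "pairwise (\<lambda>P Q. fs_dist P Q = r) {cline (a 1), B, C, D}"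
    using equi unfolding equidistant_def by blast
  then have r: "fs_dist (cline (a 1)) X = r" "X \<noteq> Y \<Longrightarrow> fs_dist X Y = r"
    if "X \<in> ?T" "Y \<in> ?T" for X Y
    using that dist by (auto simp: pairwise_def)
  have k: "cos (r / 2) = 1 / sqrt (1 + 2 * (cmod z)\<^sup>2)"
    if "X \<in> ?T" "X = cline (comb a 1 z z)" for X z
    using r(1)[OF that(1,1)] unfolding that(2) comb_axis(1)[of a]
    by (auto simp: cos_half_dist_comb[OF a] norm_divide)
  have rep: "\<exists>z. X = cline (comb a 1 z z)" if "X \<in> ?T" "X \<noteq> cline (comb a 0 1 1)" for X
    using that assms points_on_line[OF a l, of X] by (metis empty_iff insert_iff)
  \<comment> \<open>A vertex at infinity would make \<open>cos (r / 2)\<close> zero, but another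
    vertex has a finite coordinate, where this cosine is positive.\<close>
  have "cline (comb a 0 1 1) \<notin> ?T"
  proof
    assume E: "cline (comb a 0 1 1) \<in> ?T"
    have "cos (r / 2) = 0"
      using r(1)[OF E E] unfolding comb_axis(1)[of a] by (auto simp: cos_half_dist_comb[OF a])
    moreover obtain X where "X \<in> ?T" "X \<noteq> cline (comb a 0 1 1)"
      using dist by (metis distinct_length_2_or_more insertCI)
    ultimately obtain z where "1 / sqrt (1 + 2 * (cmod z)\<^sup>2) = 0"
      using rep k by metis
    then show False
      by (simp add: add_nonneg_eq_0_iff)
  qed
  then obtain z where z: "X = cline (comb a 1 (z X) (z X))" if "X \<in> ?T" for X
    using rep by metis
  define \<rho> where "\<rho> = (cmod (z B))\<^sup>2"
  have \<rho>: "(cmod (z X))\<^sup>2 = \<rho>" if "X \<in> ?T" for X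
  proof -
    have "1 / sqrt (1 + 2 * (cmod (z X))\<^sup>2) = 1 / sqrt (1 + 2 * \<rho>)"
      using k[OF that z[OF that]] k[OF _ z[of B]] by (simp add: \<rho>_def)
    then show ?thesis
      by simp
  qed
  have "\<rho> \<ge> 0"
    by (simp add: \<rho>_def)
  \<comment> \<open>The distance equation becomes
    \<open>sqrt (1 + 2 * \<rho>) = cmod (1 + 2 * t)\<close> for \<open>t = z X * cnj (z Y)\<close>.
    Squaring it, with \<open>(cmod t)\<^sup>2 = \<rho>\<^sup>2\<close>, determines
    \<open>Re t\<close>.\<close>
  have d: "Re (z X * cnj (z Y)) = \<rho> / 2 - \<rho>\<^sup>2" if XY: "X \<in> ?T" "Y \<in> ?T" "X \<noteq> Y" for X Y
  proof -
    let ?t = "z X * cnj (z Y)"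
    have "1 / sqrt (1 + 2 * \<rho>) = cos (r / 2)"
      using k[OF that(1) z[OF that(1)]] by (simp add: \<rho>[OF that(1)])
    also have "\<dots> = cmod (1 + ?t + ?t) / (sqrt (1 + \<rho> + \<rho>) * sqrt (1 + \<rho> + \<rho>))"
      using cos_half_dist_comb[OF a, of 1 "z X" "z X" 1 "z Y" "z Y"]
      unfolding \<rho>[OF XY(1)] \<rho>[OF XY(2)] z[OF XY(1), symmetric] z[OF XY(2), symmetric] r(2)[OF XY]
      by simp
    also have "\<dots> = cmod (1 + 2 * ?t) / (1 + 2 * \<rho>)"
      using \<open>\<rho> \<ge> 0\<close> by (simp add: add.assoc flip: mult_2)
    finally have "sqrt (1 + 2 * \<rho>) = cmod (1 + 2 * ?t)"
      using \<open>\<rho> \<ge> 0\<close> by (simp add: field_simps real_div_sqrt)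
    then have "(cmod (1 + 2 * ?t))\<^sup>2 = 1 + 2 * \<rho>"
      using \<open>\<rho> \<ge> 0\<close> by (metis add_nonneg_nonneg mult_nonneg_nonneg real_sqrt_pow2 zero_le_numeral zero_le_one)
    moreover have "(cmod (1 + 2 * t))\<^sup>2 = 1 + 4 * Re t + 4 * (cmod t)\<^sup>2" for t
      by (simp add: cmod_power2) (simp add: power2_eq_square algebra_simps)
    moreover have "(cmod ?t)\<^sup>2 = \<rho>\<^sup>2"
      unfolding norm_mult complex_mod_cnj power_mult_distrib \<rho>[OF XY(1)] \<rho>[OF XY(2)]
      by (simp add: power2_eq_square)
    ultimately show ?thesis
      by simp
  qed
  have "z B \<noteq> z C"
    using z[of B] z[of C] dist by auto
  \<comment> \<open>This is \<open>2 * \<rho> - 2 * \<rho>\<^sup>2 = 0\<close>, which leaves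
    \<open>\<rho> = 1\<close> and the inner product -1/2.\<close>
  then have "\<rho> + 2 * (\<rho> / 2 - \<rho>\<^sup>2) = 0" "\<rho> \<noteq> 0"
    using equal_gram_plane[OF \<rho>[of B] \<rho>[of C] \<rho>[of D] d[of B C] d[of B D] d[of C D]] dist
    by simp_all
  then have "\<rho> = 1"
    by (simp add: power2_eq_square)
  show thesis
  proof (rule that)
    have "cmod (z X) = 1" if "X \<in> ?T" for X
      using \<rho>[OF that] \<open>\<rho> = 1\<close> by (simp add: abs_square_eq_1)
    then show "\<forall>X\<in>?T. cmod (z X) = 1 \<and> X = cline (comb a 1 (z X) (z X))"
      using z by blast
    show "\<forall>X\<in>?T. \<forall>Y\<in>?T. X \<noteq> Y \<longrightarrow> Re (z X * cnj (z Y)) = - 1 / 2"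
    proof (intro ballI impI)
      fix X Y assume "X \<in> ?T" "Y \<in> ?T" "X \<noteq> Y"
      then show "Re (z X * cnj (z Y)) = - 1 / 2"
        using d[of X Y] \<open>\<rho> = 1\<close> by simp
    qed
  qed
qed

theorem theorem1p1:
  fixes A A' A'' E E' E'' B C D :: cpoint
    and m S1 l :: "cpoint set"
    and \<gamma> RP \<gamma>' \<gamma>'' :: "cpoint \<Rightarrow> cpoint set"
  assumes "distinct [A, A', A'']" and "cp_basis {A, A', A''}"
    and "complex_projective_line m" and "A' \<in> m" and "A'' \<in> m"
    and "S1 = {P \<in> m. fs_dist P A' = fs_dist P A''}"
    and "E \<in> S1" and "E' \<in> S1" and "E'' \<in> S1"
    and "fs_dist E E' = 2 * pi / 3" and "fs_dist E' E'' = 2 * pi / 3"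
    and "fs_dist E E'' = 2 * pi / 3"
    and "complex_projective_line l" and "A \<in> l" and "E \<in> l"
    and "B \<in> l" and "C \<in> l" and "D \<in> l"
    and "distinct [A, B, C, D]" and "equidistant {A, B, C, D}"
    and "\<And>X. X \<in> {B, C, D} \<Longrightarrow> great_circle_in l (\<gamma> X) \<and> {A, X, E} \<subseteq> \<gamma> X"
    and "\<And>X. X \<in> {B, C, D} \<Longrightarrow> real_projective_plane (RP X) \<and> \<gamma> X \<subseteq> RP X \<and> S1 \<subseteq> RP X"
    and "\<And>X. X \<in> {B, C, D} \<Longrightarrow> closed_geodesic_in (RP X) (\<gamma>' X) \<and> {A, E'} \<subseteq> \<gamma>' X"
    and "\<And>X. X \<in> {B, C, D} \<Longrightarrow> closed_geodesic_in (RP X) (\<gamma>'' X) \<and> {A, E''} \<subseteq> \<gamma>'' X"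
  shows "\<exists>p' p'' :: cpoint \<Rightarrow> cpoint.
    (\<forall>X\<in>{B, C, D}. p' X \<in> \<gamma>' X \<and> p'' X \<in> \<gamma>'' X \<and>
       {X, p' X, p'' X} \<subseteq> RP X \<and> cp_basis {X, p' X, p'' X}) \<and>
    sorted_wrt cp_mutually_unbiased
      [{A, A', A''}, {B, p' B, p'' B}, {C, p' C, p'' C}, {D, p' D, p'' D}] \<and>
    (\<exists>es. list_all2 represents es
        [{A, A', A''}, {B, p' B, p'' B}, {C, p' C, p'' C}, {D, p' D, p'' D}] \<and>
      complete_MUB_system es)"
proof -
  obtain a0 where a0: "orthonormal_basis a0"
    and A0: "A = cline (a0 1)" "A' = cline (a0 2)" "A'' = cline (a0 3)"
    using cp_basisE[OF assms(2,1)] .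
  obtain a where a: "orthonormal_basis a"
    and "a 1 = a0 1" "a 2 = a0 2" "cline (a 3) = cline (a0 3)"
    and E: "E = cline (comb a 0 1 1)"
    and circle: "\<forall>P\<in>S1. \<exists>w. cmod w = 1 \<and> P = cline (comb a 0 1 w)"
    by (rule circle_frame[OF a0 assms(3-6)[unfolded A0] assms(7)])
  then have A: "A = cline (a 1)" "A' = cline (a 2)" "A'' = cline (a 3)"
    by (simp_all add: A0)
  obtain w w' where w: "cmod w = 1" "E' = cline (comb a 0 1 w)"
    and w': "cmod w' = 1" "E'' = cline (comb a 0 1 w')"
    using circle assms(8,9) by meson
  have Rew: "Re w = - 1 / 2" and "w' = cnj w"
    using equilateral_triangle_on_circle[OF a w(1) w'(1)] assms(10-12) unfolding E w(2) w'(2) by auto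
  then have E'': "E'' = cline (comb a 0 1 (cnj w))"
    using w' by simp
  obtain z where zX: "\<forall>X\<in>{B, C, D}. cmod (z X) = 1 \<and> X = cline (comb a 1 (z X) (z X))"
    and zz: "\<forall>X\<in>{B, C, D}. \<forall>Y\<in>{B, C, D}. X \<noteq> Y \<longrightarrow> Re (z X * cnj (z Y)) = - 1 / 2"
    by (rule regular_tetrahedron_on_line[OF a assms(13-20)[unfolded A E]])
  then have z: "cmod (z X) = 1" and X: "X = cline (comb a 1 (z X) (z X))"
    if "X \<in> {B, C, D}" for X
    using that by blast+
  define p' where "p' = (\<lambda>X. cline (comb a 1 (z X * w) (z X * cnj w)))"
  define p'' where "p'' = (\<lambda>X. cline (comb a 1 (z X * cnj w) (z X * w)))"
  have rep: "represents (mub a w (z X)) {X, p' X, p'' X}" if "X \<in> {B, C, D}" for X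
    using represents_mub[OF w(1) Rew a z[OF that]] unfolding p'_def p''_def X[OF that, symmetric] .
  have repA: "represents a {A, A', A''}"
    using a by (simp add: represents_def UNIV_3 A)
  have in_geo: "p' X \<in> \<gamma>' X \<and> p'' X \<in> \<gamma>'' X \<and> {X, p' X, p'' X} \<subseteq> RP X" if "X \<in> {B, C, D}" for X
  proof -
    \<comment> \<open>This membership ties the phases of the real form behind \<open>RP X\<close> to
      \<open>z X\<close>.\<close>
    have XR: "cline (comb a 1 (z X) (z X)) \<in> RP X"
      using assms(21,22)[OF that] X[OF that] by blast
    have geo: "closed_geodesic_in (RP X) (\<gamma>' X)" "closed_geodesic_in (RP X) (\<gamma>'' X)"
      using assms(23,24)[OF that] by auto
    have "p' X \<in> \<gamma>' X"
      unfolding p'_def using assms(23)[OF that] w Rew A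
      by (intro mub_point_in_geodesic[OF _ _ a geo(1) _ _ XR]) auto
    \<comment> \<open>Exchanging \<open>w\<close> and \<open>cnj w\<close> carries \<open>E'\<close>
      to \<open>E''\<close> and \<open>p' X\<close> to \<open>p'' X\<close>, so the same lemma
      applies to the conjugate root.\<close>
    moreover have "p'' X \<in> \<gamma>'' X"
      unfolding p''_def using assms(24)[OF that] w Rew A E''
      by (intro mub_point_in_geodesic[of "cnj w", OF _ _ a geo(2) _ _ XR, simplified]) auto
    ultimately show ?thesis
      using geo XR X[OF that] closed_geodesic_in_subset by auto
  qed
  let ?es = "[a, mub a w (z B), mub a w (z C), mub a w (z D)]"
  let ?Ss = "[{A, A', A''}, {B, p' B, p'' B}, {C, p' C, p'' C}, {D, p' D, p'' D}]"
  have reps: "list_all2 represents ?es ?Ss"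
    using rep repA by simp
  \<comment> \<open>Three of the six pairs involve the frame \<open>a\<close>; for the other three,
    \<open>zz\<close> makes the quotients of the phases primitive cube roots.\<close>
  have mub: "sorted_wrt mutually_unbiased ?es"
    using mutually_unbiased_frame_mub[OF w(1) Rew a] mutually_unbiased_mub[OF w(1) Rew a] z zz assms(19)
    by simp
  then have "complete_MUB_system ?es"
    by (intro complete_MUB_systemI) (auto simp: mutually_unbiased_def)
  moreover have "sorted_wrt cp_mutually_unbiased ?Ss"
    using reps mub by (simp, intro conjI; blast intro: cp_mutually_unbiasedI)
  moreover have "cp_basis {X, p' X, p'' X}" if "X \<in> {B, C, D}" for X
    using rep[OF that] by (rule represents_cp_basis)
  ultimately show ?thesis
    using in_geo reps by (intro exI[of _ p'] exI[of _ p''] exI[of _ ?es] conjI ballI) simp_all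
qed

end
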